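(* Let $K\in(0,1]$ and let $H:[0,\infty)\to[\mu,\nu]\subset(0,1)$ be a Hölder continuous function with exponent $\beta>0$ such that $\sup_{t\ge 0}H(t)<\beta$. Then there exists a finite positive constant $C(\mu,\nu,K)$ such that for all $t,s\in[0,1]$, $$\mathbb{E}\Big(B^{H(t),K}_t-B^{H(s),K}_s\Big)^2\le C(\mu,\nu,K)\,|t-s|^{2(H(t)\vee H(s))K},$$ where $a\vee b=\max(a,b)$.
   Context: $B^{H(\cdot),K}=(B^{H(t),K}_t)_{t\ge 0}$ denotes the centred Gaussian process, starting from zero, with covariance function $$R^{H(\cdot),K}(t,s)=\big(D(H(t),H(s))\big)^{K}\Big[\big(t^{H(t)+H(s)}+s^{H(t)+H(s)}\big)^{K}-|t-s|^{(H(t)+H(s))K}\Big],\qquad s,t\ge 0,$$ where for $x,y\in(0,1)$ $$D(x,y):=\frac{\sqrt{\Gamma(2x+1)\Gamma(2y+1)\sin(\pi x)\sin(\pi y)}}{2\,\Gamma(x+y+1)\sin\big(\frac{\pi(x+y)}{2}\big)}$$ and $\Gamma$ is the Gamma function.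
   Formalization: The constant C may depend on the Hölder constant of H as well as on μ, ν, K; a constant depending on μ, ν, K alone and serving all H cannot exist, since H may rise from μ to ν over an arbitrarily short interval. *)

theory Defs
  imports "HOL-Probability.Probability"
begin

text \<open>The Hoelder constant \<open>L\<close> is an explicit parameter, as in the library's notion of
  Lipschitz functions.\<close>

definition holder_on :: "real \<Rightarrow> real \<Rightarrow> 'a::metric_space set \<Rightarrow> ('a \<Rightarrow> 'b::metric_space) \<Rightarrow> bool"
  where "holder_on L \<beta> S f \<longleftrightarrow>
    0 \<le> L \<and> (\<forall>x\<in>S. \<forall>y\<in>S. dist (f x) (f y) \<le> L * dist x y powr \<beta>)"

text \<open>Degenerate (almost surely constant) variables count as Gaussian; this is needed for a
  process that starts from zero.\<close>

definition gaussian_variable :: "'a measure \<Rightarrow> ('a \<Rightarrow> real) \<Rightarrow> bool"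
  where "gaussian_variable M X \<longleftrightarrow>
    X \<in> borel_measurable M \<and>
    (\<exists>m. (AE \<omega> in M. X \<omega> = m) \<or> (\<exists>\<sigma>>0. distributed M lborel X (normal_density m \<sigma>)))"

text \<open>A family is jointly Gaussian iff all finite linear combinations are Gaussian.\<close>

definition gaussian_process :: "'a measure \<Rightarrow> 't set \<Rightarrow> ('t \<Rightarrow> 'a \<Rightarrow> real) \<Rightarrow> bool"
  where "gaussian_process M T X \<longleftrightarrow>
    prob_space M \<and>
    (\<forall>I a. finite I \<and> I \<subseteq> T \<longrightarrow> gaussian_variable M (\<lambda>\<omega>. \<Sum>t\<in>I. a t * X t \<omega>))"

definition covariance :: "'a measure \<Rightarrow> ('a \<Rightarrow> real) \<Rightarrow> ('a \<Rightarrow> real) \<Rightarrow> real"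
  where "covariance M X Y =
    (\<integral>\<omega>. (X \<omega> - (\<integral>\<omega>'. X \<omega>' \<partial>M)) * (Y \<omega> - (\<integral>\<omega>'. Y \<omega>' \<partial>M)) \<partial>M)"

definition D_fun :: "real \<Rightarrow> real \<Rightarrow> real"
  where "D_fun x y =
    sqrt (Gamma (2 * x + 1) * Gamma (2 * y + 1) * sin (pi * x) * sin (pi * y)) /
    (2 * Gamma (x + y + 1) * sin (pi * (x + y) / 2))"

text \<open>Note that \<open>0 powr a = 0\<close>, which is the intended value since all exponents are positive.\<close>

definition R_cov :: "(real \<Rightarrow> real) \<Rightarrow> real \<Rightarrow> real \<Rightarrow> real \<Rightarrow> real"
  where "R_cov H K t s =
    D_fun (H t) (H s) powr K *
    ((t powr (H t + H s) + s powr (H t + H s)) powr K - \<bar>t - s\<bar> powr ((H t + H s) * K))"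

definition multifractional_bifractional_BM ::
    "'a measure \<Rightarrow> (real \<Rightarrow> real) \<Rightarrow> real \<Rightarrow> (real \<Rightarrow> 'a \<Rightarrow> real) \<Rightarrow> bool"
  where "multifractional_bifractional_BM M H K B \<longleftrightarrow>
    gaussian_process M {0..} B \<and>
    (AE \<omega> in M. B 0 \<omega> = 0) \<and>
    (\<forall>t\<ge>0. (\<integral>\<omega>. B t \<omega> \<partial>M) = 0) \<and>
    (\<forall>t\<ge>0. \<forall>s\<ge>0. covariance M (B t) (B s) = R_cov H K t s)"

end

theory Submission
  imports Defs
begin

text \<open>
  Write \<open>a = H t\<close>, \<open>b = H s\<close>, \<open>h = \<bar>t - s\<bar> \<le> 1\<close>. On the diagonal \<open>D a a = 1/2\<close>, so the process has
  variance \<open>t^(2aK)\<close> at time \<open>t\<close>, and its increment has second moment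
  \<open>t^(2aK) + s^(2bK) - 2 D\<^sup>K ((t^(a+b) + s^(a+b))\<^sup>K - h^((a+b) K))\<close> with \<open>D = D a b\<close>
  (\<open>increment_second_moment\<close>). This is an explicit function of four numbers. Since \<open>H\<close> stays below its Hoelder exponent and \<open>h \<le> 1\<close>,
  the only link between them that matters is \<open>\<bar>a - b\<bar> \<le> L h powr max a b\<close>. By symmetry let
  \<open>b \<le> a\<close>; every deviation must be paid for by \<open>h^(2aK)\<close>. With
  \<open>S = (t^(a+b) + s^(a+b)) / 2\<close> the second moment is the sum of three terms.

  \<^item> \<open>t^(2aK) + s^(2bK) - 2 S\<^sup>K\<close>. Concavity of \<open>x\<^sup>K\<close> replaces \<open>2 S\<^sup>K\<close> by \<open>t^((a+b) K) + s^((a+b) K)\<close>.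
    In the variables \<open>v = t^(aK)\<close>, \<open>w = s^(aK)\<close> and \<open>c = b / a\<close> this bounds the term by
    \<open>g w - g v + (w\<^sup>c - w)\<^sup>2\<close> with \<open>g x = x^(1+c) - x\<^sup>2\<close>. The function \<open>g\<close> degenerates as \<open>c\<close> tends
    to \<open>1\<close>: it is Lipschitz on the unit interval with constant \<open>3 (1 - c)\<close>, where
    \<open>1 - c = (a - b) / a\<close> is at most of order \<open>h\<^sup>a\<close>, while \<open>\<bar>v - w\<bar> \<le> h^(aK)\<close>. The product is of order
    \<open>h^(a+aK)\<close>, and the square of order \<open>h^(2a)\<close> (\<open>diagonal_increment_bound\<close>).

  \<^item> \<open>2 (1 - (2 D)\<^sup>K) S\<^sup>K\<close>. Here \<open>2 D\<close> falls short of its diagonal value \<open>1\<close> at most quadratically in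
    \<open>a - b\<close>: its Gamma factor is at least \<open>1\<close> by log-convexity, and its sine factor is computed
    exactly (\<open>D_fun_lower_bound\<close>).

  \<^item> \<open>2 D\<^sup>K h^((a+b) K)\<close>. The exponent is too small by \<open>(a - b) K\<close>, which is at most of order \<open>h\<^sup>a\<close>, and
    \<open>h\<^sup>a \<bar>ln h\<bar>\<close> is bounded (\<open>powr_exponent_perturbation\<close>); \<open>D\<close> is bounded as well.
\<close>

section \<open>Inequalities for real powers\<close>

lemma powr_midpoint_concave:
  fixes x y K :: real
  assumes "0 \<le> x" "0 \<le> y" "0 < K" "K \<le> 1"
  shows "x powr K + y powr K \<le> 2 * ((x + y) / 2) powr K"
proof (cases "x + y = 0")
  case True
  then have "x = 0" "y = 0" using assms by auto
  then show ?thesis by simp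
next
  case False
  define m where "m = (x + y) / 2"
  have m: "m > 0" using False assms by (auto simp: m_def)
  \<comment> \<open>Up to the factor \<open>m powr (1 - K)\<close>, this is the tangent line of the concave power at \<open>m\<close>.\<close>
  have young: "z powr K * m powr (1 - K) \<le> K * z + (1 - K) * m" if "z \<ge> 0" for z
  proof (cases "z = 0")
    case True
    then show ?thesis using assms m by simp
  next
    case False
    then show ?thesis using Youngs_inequality_0[of K "1 - K" z m] assms m that by simp
  qed
  have "(x powr K + y powr K) * m powr (1 - K) \<le> K * (x + y) + 2 * (1 - K) * m"
    using young[OF assms(1)] young[OF assms(2)] by (simp add: algebra_simps)
  also have "\<dots> = 2 * m" by (simp add: m_def field_simps)
  also have "\<dots> = (2 * m powr K) * m powr (1 - K)"
    using m by (simp add: powr_add[symmetric])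
  finally show ?thesis using m by (simp add: m_def)
qed

lemma abs_powr_diff_le_powr:
  fixes x y r :: real
  assumes "0 \<le> x" "0 \<le> y" "0 < r" "r \<le> 1"
  shows "\<bar>x powr r - y powr r\<bar> \<le> \<bar>x - y\<bar> powr r"
proof -
  have subadd: "u powr r - v powr r \<le> (u - v) powr r" if "0 \<le> v" "v < u" for u v
  proof -
    have u: "u > 0" using that by simp
    have ge: "z \<le> z powr r" if "0 \<le> z" "z \<le> 1" for z
      using powr_mono'[of r 1 z] assms that by simp
    \<comment> \<open>After dividing by \<open>u\<close>, both parts lie in the unit interval,
      where an exponent at most \<open>1\<close> only increases a number.\<close>
    have "1 = v / u + (u - v) / u" using u by (simp add: field_simps)
    also have "\<dots> \<le> (v / u) powr r + ((u - v) / u) powr r"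
      using that u by (intro add_mono ge) (auto simp: field_simps)
    also have "\<dots> = (v powr r + (u - v) powr r) / u powr r"
      using that u by (simp add: powr_divide add_divide_distrib)
    finally show ?thesis using u by (simp add: field_simps)
  qed
  have mono: "v powr r \<le> u powr r" if "0 \<le> v" "v < u" for u v
    using that assms by (intro powr_mono2) auto
  show ?thesis
  proof (cases x y rule: linorder_cases)
    case less
    then show ?thesis using subadd[of x y] mono[of x y] assms by simp
  next
    case greater
    then show ?thesis using subadd[of y x] mono[of y x] assms by simp
  qed simp
qed

text \<open>Young's inequality with the second factor equal to \<open>1\<close> gives a bound that is uniform in \<open>v\<close>,
  linear in \<open>1 - c\<close>, and free of the logarithm that differentiating in \<open>c\<close> would produce.\<close>

lemma powr_minus_self_bounds:
  fixes v c :: real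
  assumes "0 \<le> v" "v \<le> 1" "0 < c" "c \<le> 1"
  shows "0 \<le> v powr c - v" "v powr c - v \<le> 1 - c"
proof -
  show "0 \<le> v powr c - v" using powr_mono'[of c 1 v] assms by simp
  show "v powr c - v \<le> 1 - c"
  proof (cases "v = 0")
    case False
    then have "v powr c \<le> c * v + (1 - c)"
      using Youngs_inequality_0[of c "1 - c" v 1] assms by simp
    moreover have "c * v \<le> v" using assms by (simp add: mult_left_le_one_le)
    ultimately show ?thesis by simp
  qed (use assms in auto)
qed

text \<open>The derivative \<open>(1 + c) x\<^sup>c - 2 x\<close> vanishes identically for \<open>c = 1\<close>. Splitting it as
  \<open>(1 + c) (x\<^sup>c - x) - (1 - c) x\<close> shows that it is small with \<open>1 - c\<close>.\<close>

lemma powr_minus_square_lipschitz: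
  fixes v w c :: real
  assumes "v \<in> {0..1}" "w \<in> {0..1}" "0 < c" "c \<le> 1"
  shows "\<bar>(w powr (1 + c) - w\<^sup>2) - (v powr (1 + c) - v\<^sup>2)\<bar> \<le> 3 * (1 - c) * \<bar>w - v\<bar>"
proof -
  define g where "g = (\<lambda>x::real. x powr (1 + c) - x\<^sup>2)"
  have main: "\<bar>g q - g p\<bar> \<le> 3 * (1 - c) * \<bar>q - p\<bar>" if "0 \<le> p" "p < q" "q \<le> 1" for p q
  proof -
    have der: "(g has_real_derivative (1 + c) * z powr c - 2 * z) (at z)" if "z > 0" for z
      unfolding g_def using that by (auto intro!: derivative_eq_intros)
    have cont: "continuous_on {p..q} g"
      unfolding g_def using \<open>0 \<le> p\<close> assms
      by (intro continuous_intros continuous_on_powr') auto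
    obtain l z where z: "p < z" "z < q" and l: "DERIV g z :> l" and eq: "g q - g p = (q - p) * l"
      using MVT[OF \<open>p < q\<close> cont] der \<open>0 \<le> p\<close>
      by (metis (no_types, opaque_lifting) le_less_trans real_differentiable_def)
    have zpos: "0 < z" "z \<le> 1" using z that by auto
    have "l = (1 + c) * z powr c - 2 * z" using DERIV_unique[OF l der] zpos by simp
    also have "\<dots> = (1 + c) * (z powr c - z) - (1 - c) * z" by (simp add: algebra_simps)
    finally have l_eq: "l = (1 + c) * (z powr c - z) - (1 - c) * z" .
    have b: "0 \<le> z powr c - z" "z powr c - z \<le> 1 - c"
      using powr_minus_self_bounds[of z c] zpos assms by auto
    have "0 \<le> (1 + c) * (z powr c - z)" using b assms by simp
    moreover have "(1 + c) * (z powr c - z) \<le> 2 * (1 - c)"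
      using b assms by (intro mult_mono) auto
    moreover have "0 \<le> (1 - c) * z" "(1 - c) * z \<le> 1 - c"
      using zpos assms by (auto intro!: mult_left_le)
    ultimately have "\<bar>l\<bar> \<le> 3 * (1 - c)"
      unfolding l_eq abs_le_iff using assms by (simp only: atLeastAtMost_iff) argo
    then show ?thesis unfolding eq abs_mult using that by (simp add: mult.commute mult_left_mono)
  qed
  show ?thesis
  proof (cases v w rule: linorder_cases)
    case less
    then show ?thesis using main[of v w] assms by (simp add: g_def)
  next
    case greater
    then show ?thesis using main[of w v] assms by (simp add: g_def abs_minus_commute)
  qed simp
qed

text \<open>For \<open>h\<close> in the unit interval, \<open>h\<^sup>a \<bar>ln h\<bar>\<close> is at most \<open>1 / a\<close>; an exponent of order \<open>h\<^sup>a\<close> therefore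
  changes a power of \<open>h\<close> by a bounded factor only. For \<open>d = (H t - H s) K\<close> and
  \<open>h = \<bar>t - s\<bar>\<close> the assumption on \<open>d\<close> is what the Hoelder condition on \<open>H\<close> supplies.\<close>

lemma powr_exponent_perturbation:
  fixes h a d L :: real
  assumes "0 < h" "h \<le> 1" "0 < a" "0 \<le> L" "d \<le> L * h powr a"
  shows "h powr (- d) \<le> exp (L / a)"
proof -
  have ln: "0 \<le> - ln h" using assms by simp
  have "ln (1 / h) \<le> (1 / h) powr a / a"
    using assms by (intro ln_powr_bound) auto
  then have *: "h powr a * (- ln h) \<le> 1 / a"
    using assms by (simp add: ln_div powr_divide field_simps)
  have "d * (- ln h) \<le> L * h powr a * (- ln h)"
    using assms(5) ln by (rule mult_right_mono)
  also have "\<dots> \<le> L * (1 / a)"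
    using mult_left_mono[OF * \<open>0 \<le> L\<close>] by (simp add: mult.assoc)
  finally show ?thesis using \<open>0 < h\<close> by (simp add: powr_def)
qed

section \<open>The normalising factor\<close>

lemma Gamma_midpoint_le:
  fixes u v :: real
  assumes "0 < u" "0 < v"
  shows "(Gamma ((u + v) / 2))\<^sup>2 \<le> Gamma u * Gamma v"
proof -
  define m where "m = (u + v) / 2"
  have m: "m > 0" using assms by (simp add: m_def)
  have pos: "0 < Gamma u" "0 < Gamma v" "0 < (Gamma m)\<^sup>2"
    using assms m by (simp_all add: less_imp_neq[symmetric])
  have "m = (1 - 1/2) *\<^sub>R u + (1/2) *\<^sub>R v" by (simp add: m_def field_simps)
  then have "ln (Gamma m) \<le> (1 - 1/2) * ln (Gamma u) + (1/2) * ln (Gamma v)"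
    using convex_onD[OF log_convex_Gamma_real, of "1/2" u v] assms by (simp add: o_def)
  then have "ln ((Gamma m)\<^sup>2) \<le> ln (Gamma u * Gamma v)"
    using assms m by (simp add: ln_mult ln_realpow Gamma_real_pos less_imp_neq[symmetric])
  then have "(Gamma m)\<^sup>2 \<le> Gamma u * Gamma v"
    using pos by (simp only: ln_le_cancel_iff mult_pos_pos)
  then show ?thesis by (simp add: m_def)
qed

lemma sin_mult_sin_eq:
  fixes u v :: real
  shows "sin u * sin v = (sin ((u + v) / 2))\<^sup>2 - (sin ((u - v) / 2))\<^sup>2"
proof -
  have "cos (u - v) = 1 - 2 * (sin ((u - v) / 2))\<^sup>2"
    and "cos (u + v) = 1 - 2 * (sin ((u + v) / 2))\<^sup>2"
    using cos_double_sin[of "(u - v) / 2"] cos_double_sin[of "(u + v) / 2"]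
    by (simp_all only: nonzero_mult_div_cancel_left times_divide_eq_right
        zero_neq_numeral[symmetric] not_False_eq_True)
  then show ?thesis by (simp add: sin_times_sin field_simps)
qed

lemma sin_pi_pos: "0 < x \<Longrightarrow> x < 1 \<Longrightarrow> 0 < sin (pi * x)"
  by (intro sin_gt_zero) (auto simp: field_simps)

lemma D_fun_commute: "D_fun x y = D_fun y x"
  by (simp add: D_fun_def add.commute mult.commute mult.left_commute)

lemma D_fun_pos:
  assumes "x \<in> {0<..<1}" "y \<in> {0<..<1}"
  shows "0 < D_fun x y"
  using assms sin_pi_pos[of x] sin_pi_pos[of y] sin_pi_pos[of "(x + y) / 2"]
  by (auto simp: D_fun_def intro!: divide_pos_pos mult_pos_pos)

lemma D_fun_diagonal:
  assumes "x \<in> {0<..<1}"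
  shows "D_fun x x = 1 / 2"
proof -
  have p: "0 < Gamma (2 * x + 1)" "0 < sin (pi * x)" using assms sin_pi_pos[of x] by auto
  have "Gamma (2 * x + 1) * Gamma (2 * x + 1) * sin (pi * x) * sin (pi * x)
      = (Gamma (2 * x + 1) * sin (pi * x))\<^sup>2"
    by (simp add: power2_eq_square mult_ac)
  moreover have "x + x + 1 = 2 * x + 1" "pi * (x + x) / 2 = pi * x" by (auto simp: field_simps)
  ultimately show ?thesis using p by (simp add: D_fun_def real_sqrt_abs)
qed

text \<open>The square separates into a Gamma factor, which is at least \<open>1\<close>, and a sine factor, which is
  at most \<open>1\<close>; both equal \<open>1\<close> on the diagonal.\<close>

lemma D_fun_square:
  assumes "x \<in> {0<..<1}" "y \<in> {0<..<1}"
  shows "(2 * D_fun x y)\<^sup>2 =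
    (Gamma (2 * x + 1) * Gamma (2 * y + 1) / (Gamma (x + y + 1))\<^sup>2) *
    (1 - (sin (pi * (x - y) / 2))\<^sup>2 / (sin (pi * (x + y) / 2))\<^sup>2)"
proof -
  have p: "0 < sin (pi * x)" "0 < sin (pi * y)" "0 < sin (pi * (x + y) / 2)"
    using assms sin_pi_pos[of x] sin_pi_pos[of y] sin_pi_pos[of "(x + y) / 2"] by auto
  have g: "0 < Gamma (2 * x + 1)" "0 < Gamma (2 * y + 1)" "0 < Gamma (x + y + 1)"
    using assms by auto
  have "(2 * D_fun x y)\<^sup>2 = Gamma (2 * x + 1) * Gamma (2 * y + 1) * (sin (pi * x) * sin (pi * y)) /
      (Gamma (x + y + 1) * sin (pi * (x + y) / 2))\<^sup>2"
    using p g by (simp add: D_fun_def power_divide power_mult_distrib mult_ac)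
  also have "sin (pi * x) * sin (pi * y) =
      (sin (pi * (x + y) / 2))\<^sup>2 - (sin (pi * (x - y) / 2))\<^sup>2"
    using sin_mult_sin_eq[of "pi * x" "pi * y"] by (simp add: algebra_simps)
  finally show ?thesis using p g by (simp add: field_simps power_mult_distrib)
qed

text \<open>Bounding \<open>2 D\<close> itself from below by a Taylor expansion would need two derivatives of Gamma.
  With log-convexity the Gamma factor can be dropped from the lower bound, and
  the sine factor differs from \<open>1\<close> by at most a multiple of \<open>(x - y)\<^sup>2\<close>, because
  \<open>sin (pi (x + y) / 2)\<close> stays away from \<open>0\<close> for \<open>x, y\<close> in a compact part of the unit interval.\<close>

lemma D_fun_lower_bound:
  assumes "0 < \<mu>" "\<mu> \<le> \<nu>" "\<nu> < 1"
  shows "\<exists>c\<ge>0. \<forall>x\<in>{\<mu>..\<nu>}. \<forall>y\<in>{\<mu>..\<nu>}. 1 - c * (x - y)\<^sup>2 \<le> (2 * D_fun x y)\<^sup>2"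
proof -
  have "continuous_on {\<mu>..\<nu>} (\<lambda>z. sin (pi * z))" by (intro continuous_intros)
  then obtain z0 where z0: "z0 \<in> {\<mu>..\<nu>}" "\<And>z. z \<in> {\<mu>..\<nu>} \<Longrightarrow> sin (pi * z0) \<le> sin (pi * z)"
    using continuous_attains_inf[of "{\<mu>..\<nu>}"] assms by (metis atLeastatMost_empty_iff compact_Icc)
  define \<sigma> where "\<sigma> = sin (pi * z0)"
  have \<sigma>: "\<sigma> > 0" using z0(1) assms by (auto simp: \<sigma>_def intro!: sin_pi_pos)
  define c where "c = (pi / 2)\<^sup>2 / \<sigma>\<^sup>2"
  have "1 - c * (x - y)\<^sup>2 \<le> (2 * D_fun x y)\<^sup>2" if xy: "x \<in> {\<mu>..\<nu>}" "y \<in> {\<mu>..\<nu>}" for x y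
  proof -
    have xy01: "x \<in> {0<..<1}" "y \<in> {0<..<1}" using xy assms by auto
    define q where "q = (sin (pi * (x - y) / 2))\<^sup>2 / (sin (pi * (x + y) / 2))\<^sup>2"
    define \<gamma> where "\<gamma> = Gamma (2 * x + 1) * Gamma (2 * y + 1) / (Gamma (x + y + 1))\<^sup>2"
    have "(x + y) / 2 \<in> {\<mu>..\<nu>}" using xy by auto
    from z0(2)[OF this] have s: "\<sigma> \<le> sin (pi * (x + y) / 2)" by (simp add: \<sigma>_def)
    have "(sin (pi * (x - y) / 2))\<^sup>2 \<le> (pi * (x - y) / 2)\<^sup>2"
      using abs_sin_x_le_abs_x[of "pi * (x - y) / 2"] by (simp only: abs_le_square_iff)
    moreover have "\<sigma>\<^sup>2 \<le> (sin (pi * (x + y) / 2))\<^sup>2" using s \<sigma> by (intro power_mono) auto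
    ultimately have "q \<le> (pi * (x - y) / 2)\<^sup>2 / \<sigma>\<^sup>2"
      unfolding q_def using \<sigma> by (intro frac_le) auto
    then have q: "q \<le> c * (x - y)\<^sup>2"
      by (simp add: c_def power_mult_distrib power_divide)
    have eq: "(2 * D_fun x y)\<^sup>2 = \<gamma> * (1 - q)"
      unfolding \<gamma>_def q_def by (rule D_fun_square[OF xy01])
    have mid: "(2 * x + 1 + (2 * y + 1)) / 2 = x + y + 1" by (simp add: field_simps)
    have "(Gamma (x + y + 1))\<^sup>2 \<le> Gamma (2 * x + 1) * Gamma (2 * y + 1)"
      using Gamma_midpoint_le[of "2 * x + 1" "2 * y + 1", unfolded mid] xy01 by simp
    moreover have "0 < Gamma (x + y + 1)" using xy01 by auto
    ultimately have \<gamma>: "1 \<le> \<gamma>" by (simp add: \<gamma>_def)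
    \<comment> \<open>The sign of \<open>1 - q\<close> is needed to drop the factor \<open>\<gamma> \<ge> 1\<close>; it is read off from \<open>D > 0\<close>.\<close>
    have "0 < \<gamma> * (1 - q)" using D_fun_pos[OF xy01] unfolding eq[symmetric] by simp
    then have "0 < 1 - q" using \<gamma> by (simp add: zero_less_mult_iff)
    then have "1 - q \<le> \<gamma> * (1 - q)" using \<gamma> by simp
    then show ?thesis using q unfolding eq by linarith
  qed
  moreover have "c \<ge> 0" by (simp add: c_def)
  ultimately show ?thesis by blast
qed

lemma D_fun_bounded: "\<exists>G>0. \<forall>x\<in>{0<..<1}. \<forall>y\<in>{0<..<1}. D_fun x y \<le> G"
proof -
  have "continuous_on {1..3} (Gamma :: real \<Rightarrow> real)"
    by (intro continuous_on_Gamma) (auto elim!: nonpos_Ints_cases)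
  then obtain lo hi :: real where lo: "lo \<in> {1..3}" "\<And>z. z \<in> {1..3} \<Longrightarrow> Gamma lo \<le> Gamma z"
    and hi: "hi \<in> {1..3}" "\<And>z. z \<in> {1..3} \<Longrightarrow> Gamma z \<le> Gamma hi"
    using continuous_attains_inf[of "{1..3::real}" Gamma]
      continuous_attains_sup[of "{1..3::real}" Gamma] by auto
  have pos: "0 < Gamma lo" "0 < Gamma hi" using lo(1) hi(1) by auto
  define G where "G = Gamma hi / Gamma lo"
  have "D_fun x y \<le> G" if xy: "x \<in> {0<..<1}" "y \<in> {0<..<1}" for x y
  proof -
    define q where "q = (sin (pi * (x - y) / 2))\<^sup>2 / (sin (pi * (x + y) / 2))\<^sup>2"
    have "(2 * D_fun x y)\<^sup>2 =
        Gamma (2 * x + 1) * Gamma (2 * y + 1) / (Gamma (x + y + 1))\<^sup>2 * (1 - q)"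
      unfolding q_def by (rule D_fun_square[OF xy])
    also have "\<dots> \<le> Gamma (2 * x + 1) * Gamma (2 * y + 1) / (Gamma (x + y + 1))\<^sup>2 * 1"
      using xy by (intro mult_left_mono) (auto simp: q_def intro!: divide_nonneg_nonneg mult_nonneg_nonneg)
    also have "\<dots> \<le> (Gamma hi * Gamma hi) / (Gamma lo)\<^sup>2"
      using xy pos by (simp, intro frac_le mult_mono power_mono lo hi) auto
    also have "\<dots> = G\<^sup>2" by (simp add: G_def power_divide power2_eq_square)
    finally have "2 * D_fun x y \<le> G"
      by (rule power2_le_imp_le) (use pos in \<open>simp add: G_def\<close>)
    then show ?thesis using D_fun_pos[OF xy] by linarith
  qed
  moreover have "G > 0" using pos by (simp add: G_def)
  ultimately show ?thesis by blast
qed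

section \<open>The increment variance as a function of four numbers\<close>

text \<open>The expression is the increment variance with \<open>D\<close> replaced by its diagonal value and
  without the term in \<open>\<bar>t - s\<bar>\<close>. Concavity bounds it by \<open>v\<^sup>2 - v v\<^sup>c + (w\<^sup>c)\<^sup>2 - w w\<^sup>c\<close>; both
  differences are of first order in \<open>1 - c\<close>, and for \<open>K > 1/2\<close> the second alone is too large, but
  they have opposite signs.
  Completing the square in \<open>w\<^sup>c - w\<close> makes the cancellation explicit as an increment of
  \<open>x^(1+c) - x\<^sup>2\<close>.\<close>

lemma diagonal_increment_bound:
  fixes t s a b K :: real
  assumes "t \<in> {0..1}" "s \<in> {0..1}" "0 < b" "b \<le> a" "a < 1" "0 < K" "K \<le> 1"
  shows "t powr (2 * a * K) + s powr (2 * b * K)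
      - 2 * ((t powr (a + b) + s powr (a + b)) / 2) powr K
    \<le> 3 * ((a - b) / a) * \<bar>t - s\<bar> powr (a * K) + ((a - b) / a)\<^sup>2"
proof -
  have a: "0 < a" using assms by simp
  have aK: "0 < a * K" "a * K \<le> 1" using assms by (auto intro!: mult_le_one)
  define c where "c = b / a"
  have c: "0 < c" "c \<le> 1" "1 - c = (a - b) / a" using assms by (auto simp: c_def field_simps)
  define v where "v = t powr (a * K)"
  define w where "w = s powr (a * K)"
  have vw: "v \<in> {0..1}" "w \<in> {0..1}" using assms aK by (auto simp: v_def w_def powr_le1)
  have exps: "a * K * (1 + c) = (a + b) * K" "a * K * c = b * K"
    using a by (auto simp: c_def field_simps)
  have "t powr ((a + b) * K) + s powr ((a + b) * K)
      \<le> 2 * ((t powr (a + b) + s powr (a + b)) / 2) powr K"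
    using powr_midpoint_concave[of "t powr (a + b)" "s powr (a + b)" K] assms
    by (simp add: powr_powr)
  moreover have "t powr ((a + b) * K) = v powr (1 + c)" "s powr ((a + b) * K) = w powr (1 + c)"
    by (simp_all only: v_def w_def powr_powr exps)
  moreover have "t powr (2 * a * K) = v\<^sup>2"
    by (simp only: v_def power2_eq_square powr_add[symmetric] mult_2 distrib_right)
  moreover have "s powr (2 * b * K) = (w powr c)\<^sup>2"
    by (simp only: w_def powr_powr exps power2_eq_square powr_add[symmetric] mult_2 distrib_right)
  moreover have "w * w powr c = w powr (1 + c)" "0 \<le> w"
    using vw by (auto simp: powr_add powr_one_gt_zero_iff)
  then have "v\<^sup>2 - v powr (1 + c) + (w powr c)\<^sup>2 - w powr (1 + c)
      = (w powr (1 + c) - w\<^sup>2) - (v powr (1 + c) - v\<^sup>2) + (w powr c - w)\<^sup>2"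
    by (simp add: power2_eq_square algebra_simps)
  moreover have "(w powr (1 + c) - w\<^sup>2) - (v powr (1 + c) - v\<^sup>2) \<le> 3 * (1 - c) * \<bar>w - v\<bar>"
    using powr_minus_square_lipschitz[OF vw c(1,2)] by simp
  moreover have "3 * (1 - c) * \<bar>w - v\<bar> \<le> 3 * (1 - c) * \<bar>t - s\<bar> powr (a * K)"
    using abs_powr_diff_le_powr[of s t "a * K"] assms aK c
    by (intro mult_left_mono) (auto simp: v_def w_def abs_minus_commute)
  moreover have "(w powr c - w)\<^sup>2 \<le> (1 - c)\<^sup>2"
    using powr_minus_self_bounds[of w c] vw c(1,2) by (intro power_mono) auto
  ultimately show ?thesis unfolding c(3)[symmetric] by linarith
qed

definition increment_variance :: "real \<Rightarrow> real \<Rightarrow> real \<Rightarrow> real \<Rightarrow> real \<Rightarrow> real"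
  where "increment_variance K a b t s =
    t powr (2 * a * K) + s powr (2 * b * K) - 2 * (D_fun a b powr K *
      ((t powr (a + b) + s powr (a + b)) powr K - \<bar>t - s\<bar> powr ((a + b) * K)))"

lemma increment_variance_commute: "increment_variance K a b t s = increment_variance K b a s t"
  by (simp add: increment_variance_def D_fun_commute[of a b] add.commute abs_minus_commute)

text \<open>The factor \<open>h\<^sup>a\<close> in the assumption suffices because \<open>K \<le> 1\<close> and \<open>h \<le> 1\<close>: each of
  \<open>h\<^sup>a h^(aK)\<close> and \<open>h^(2a)\<close> is at most \<open>h^(2aK)\<close>.\<close>

lemma increment_variance_bound_ordered:
  fixes \<mu> \<nu> K L :: real
  assumes "0 < \<mu>" "\<mu> \<le> \<nu>" "\<nu> < 1" "0 < K" "K \<le> 1" "0 \<le> L"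
  shows "\<exists>C>0. \<forall>a\<in>{\<mu>..\<nu>}. \<forall>b\<in>{\<mu>..\<nu>}. \<forall>t\<in>{0..1}. \<forall>s\<in>{0..1}.
    b \<le> a \<longrightarrow> a - b \<le> L * \<bar>t - s\<bar> powr a \<longrightarrow>
    increment_variance K a b t s \<le> C * \<bar>t - s\<bar> powr (2 * a * K)"
proof -
  obtain c where c: "c \<ge> 0"
    "\<And>x y. x \<in> {\<mu>..\<nu>} \<Longrightarrow> y \<in> {\<mu>..\<nu>} \<Longrightarrow> 1 - c * (x - y)\<^sup>2 \<le> (2 * D_fun x y)\<^sup>2"
    using D_fun_lower_bound[OF assms(1-3)] by blast
  obtain G where G: "G > 0"
    "\<And>x y. x \<in> {0<..<1} \<Longrightarrow> y \<in> {0<..<1} \<Longrightarrow> D_fun x y \<le> G"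
    using D_fun_bounded by blast
  define C where "C = 3 * (L / \<mu>) + (L / \<mu>)\<^sup>2 + 2 * (c * L\<^sup>2) + 2 * (G powr K * exp (L / \<mu>))"
  have "increment_variance K a b t s \<le> C * \<bar>t - s\<bar> powr (2 * a * K)"
    if ab: "a \<in> {\<mu>..\<nu>}" "b \<in> {\<mu>..\<nu>}" "b \<le> a" and ts: "t \<in> {0..1}" "s \<in> {0..1}"
      and hold: "a - b \<le> L * \<bar>t - s\<bar> powr a" for a b t s
  proof -
    define h where "h = \<bar>t - s\<bar>"
    have h: "0 \<le> h" "h \<le> 1" using ts by (auto simp: h_def)
    have ab01: "a \<in> {0<..<1}" "b \<in> {0<..<1}" "0 < a" "0 < b" "a < 1" using ab assms by auto
    have aK: "a * K \<le> a" using ab01 assms by (simp add: mult_left_le)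
    have "(a - b) / a \<le> (a - b) / \<mu>" using ab assms by (intro divide_left_mono) auto
    also have "\<dots> \<le> L * h powr a / \<mu>"
      using hold assms by (simp add: h_def divide_right_mono)
    finally have ratio: "(a - b) / a \<le> L / \<mu> * h powr a" by simp
    have ratio0: "0 \<le> (a - b) / a" using ab ab01 by simp
    have hh: "h powr a * h powr (a * K) \<le> h powr (2 * a * K)"
      using h aK by (simp only: powr_add[symmetric]) (intro powr_mono', auto simp: mult.commute)
    have h2: "(h powr a)\<^sup>2 \<le> h powr (2 * a * K)"
      using h aK by (simp only: power2_eq_square powr_add[symmetric]) (intro powr_mono', auto simp: mult.commute)

    have "t powr (2 * a * K) + s powr (2 * b * K)
        - 2 * ((t powr (a + b) + s powr (a + b)) / 2) powr K
      \<le> 3 * ((a - b) / a) * h powr (a * K) + ((a - b) / a)\<^sup>2"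
      unfolding h_def using diagonal_increment_bound[OF ts] ab ab01 assms by blast
    also have "\<dots> \<le> 3 * (L / \<mu> * h powr a) * h powr (a * K) + (L / \<mu> * h powr a)\<^sup>2"
      by (intro add_mono mult_right_mono mult_left_mono power_mono ratio ratio0) auto
    also have "\<dots> = 3 * (L / \<mu>) * (h powr a * h powr (a * K)) + (L / \<mu>)\<^sup>2 * (h powr a)\<^sup>2"
      by (simp only: power_mult_distrib mult.assoc)
    also have "\<dots> \<le> 3 * (L / \<mu>) * h powr (2 * a * K) + (L / \<mu>)\<^sup>2 * h powr (2 * a * K)"
      using assms by (intro add_mono mult_left_mono hh h2) auto
    finally have part1: "t powr (2 * a * K) + s powr (2 * b * K)
        - 2 * ((t powr (a + b) + s powr (a + b)) / 2) powr K
      \<le> (3 * (L / \<mu>) + (L / \<mu>)\<^sup>2) * h powr (2 * a * K)"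
      by (simp add: distrib_right)

    define S where "S = (t powr (a + b) + s powr (a + b)) / 2"
    define E where "E = (2 * D_fun a b) powr K"
    have S: "0 \<le> S" "S \<le> 1"
      using ts ab01 powr_le1[of "a + b" t] powr_le1[of "a + b" s] by (auto simp: S_def)
    then have SK: "0 \<le> S powr K" "S powr K \<le> 1" using assms by (auto simp: powr_le1)
    have Dpos: "0 < D_fun a b" by (rule D_fun_pos[OF ab01(1,2)])
    \<comment> \<open>The bound on \<open>(2 D)\<^sup>2\<close> passes to \<open>(2 D)\<^sup>K\<close>: below \<open>1\<close>, a smaller exponent only helps.\<close>
    have "1 - c * (a - b)\<^sup>2 \<le> E"
    proof (cases "2 * D_fun a b \<le> 1")
      case True
      have "(2 * D_fun a b)\<^sup>2 = (2 * D_fun a b) powr 2" using Dpos by simp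
      also have "\<dots> \<le> E" unfolding E_def using True Dpos assms by (intro powr_mono') auto
      finally show ?thesis using c(2)[OF ab(1,2)] by linarith
    next
      case False
      then have "1 \<le> E" using assms by (simp add: E_def ge_one_powr_ge_zero)
      moreover have "0 \<le> c * (a - b)\<^sup>2" using c by simp
      ultimately show ?thesis by linarith
    qed
    then have "(1 - E) * S powr K \<le> c * (a - b)\<^sup>2 * S powr K"
      using SK by (intro mult_right_mono) auto
    also have "\<dots> \<le> c * (a - b)\<^sup>2" using SK c by (intro mult_left_le) auto
    also have "\<dots> \<le> c * (L * h powr a)\<^sup>2"
      using hold ab c by (intro mult_left_mono power_mono) (auto simp: h_def)
    also have "\<dots> = c * L\<^sup>2 * (h powr a)\<^sup>2" by (simp add: power_mult_distrib)
    also have "\<dots> \<le> c * L\<^sup>2 * h powr (2 * a * K)" using c by (intro mult_left_mono h2) auto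
    finally have part2: "(1 - E) * S powr K \<le> c * L\<^sup>2 * h powr (2 * a * K)" .

    have part3: "D_fun a b powr K * h powr ((a + b) * K)
        \<le> G powr K * exp (L / \<mu>) * h powr (2 * a * K)"
    proof (cases "h = 0")
      case False
      then have hp: "h > 0" using h by simp
      have "(a - b) * K \<le> L * h powr a"
        using hold ab assms mult_left_le[of K "a - b"] by (simp add: h_def)
      then have "h powr (- ((a - b) * K)) \<le> exp (L / a)"
        using powr_exponent_perturbation[OF hp h(2) ab01(3) assms(6)] by simp
      also have "\<dots> \<le> exp (L / \<mu>)" using ab assms by (simp add: divide_left_mono)
      finally have e: "h powr (- ((a - b) * K)) \<le> exp (L / \<mu>)" .
      have "(a + b) * K = - ((a - b) * K) + 2 * a * K" by (simp add: algebra_simps)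
      then have "h powr ((a + b) * K) = h powr (- ((a - b) * K)) * h powr (2 * a * K)"
        by (simp only: powr_add)
      also have "\<dots> \<le> exp (L / \<mu>) * h powr (2 * a * K)" by (intro mult_right_mono e) auto
      finally have "h powr ((a + b) * K) \<le> exp (L / \<mu>) * h powr (2 * a * K)" .
      moreover have "D_fun a b powr K \<le> G powr K"
        using G(2)[OF ab01(1,2)] Dpos assms by (intro powr_mono2) auto
      ultimately have "D_fun a b powr K * h powr ((a + b) * K)
          \<le> G powr K * (exp (L / \<mu>) * h powr (2 * a * K))"
        by (intro mult_mono) auto
      then show ?thesis by (simp add: mult.assoc)
    qed simp

    have "D_fun a b powr K * (t powr (a + b) + s powr (a + b)) powr K = E * S powr K"
      using Dpos S by (simp add: E_def S_def powr_mult[symmetric] del: powr_mult)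
    then have "increment_variance K a b t s =
        (t powr (2 * a * K) + s powr (2 * b * K) - 2 * S powr K)
        + 2 * ((1 - E) * S powr K) + 2 * (D_fun a b powr K * h powr ((a + b) * K))"
      by (simp add: increment_variance_def h_def algebra_simps)
    also have "\<dots> \<le> C * h powr (2 * a * K)"
      using part1[folded S_def] part2 part3 by (simp add: C_def distrib_right)
    finally show ?thesis by (simp add: h_def)
  qed
  moreover have "C > 0"
    using assms c(1) G(1) by (auto simp: C_def intro!: add_nonneg_pos)
  ultimately show ?thesis by blast
qed

lemma increment_variance_bound:
  fixes \<mu> \<nu> K L :: real
  assumes "0 < \<mu>" "\<mu> \<le> \<nu>" "\<nu> < 1" "0 < K" "K \<le> 1" "0 \<le> L"
  shows "\<exists>C>0. \<forall>a\<in>{\<mu>..\<nu>}. \<forall>b\<in>{\<mu>..\<nu>}. \<forall>t\<in>{0..1}. \<forall>s\<in>{0..1}.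
    \<bar>a - b\<bar> \<le> L * \<bar>t - s\<bar> powr max a b \<longrightarrow>
    increment_variance K a b t s \<le> C * \<bar>t - s\<bar> powr (2 * max a b * K)"
proof -
  obtain C where C: "C > 0" and bound: "\<And>a b t s. a \<in> {\<mu>..\<nu>} \<Longrightarrow> b \<in> {\<mu>..\<nu>} \<Longrightarrow> t \<in> {0..1} \<Longrightarrow>
      s \<in> {0..1} \<Longrightarrow> b \<le> a \<Longrightarrow> a - b \<le> L * \<bar>t - s\<bar> powr a \<Longrightarrow>
      increment_variance K a b t s \<le> C * \<bar>t - s\<bar> powr (2 * a * K)"
    using increment_variance_bound_ordered[OF assms] by blast
  have "increment_variance K a b t s \<le> C * \<bar>t - s\<bar> powr (2 * max a b * K)"
    if "a \<in> {\<mu>..\<nu>}" "b \<in> {\<mu>..\<nu>}" "t \<in> {0..1}" "s \<in> {0..1}"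
      "\<bar>a - b\<bar> \<le> L * \<bar>t - s\<bar> powr max a b" for a b t s
  proof (cases "b \<le> a")
    case True
    then show ?thesis using bound[of a b t s] that by (simp add: max_absorb1)
  next
    case False
    then show ?thesis
      using bound[of b a s t] that increment_variance_commute[of K a b t s]
      by (simp add: max_absorb2 abs_minus_commute)
  qed
  then show ?thesis using C by blast
qed

section \<open>Second moments of the process\<close>

lemma gaussian_variable_square_integrable:
  assumes "prob_space M" and "gaussian_variable M X"
  shows "integrable M (\<lambda>\<omega>. (X \<omega>)\<^sup>2)"
proof -
  interpret prob_space M by fact
  have X[measurable]: "X \<in> borel_measurable M"
    using assms(2) by (simp add: gaussian_variable_def)
  obtain m where "(AE \<omega> in M. X \<omega> = m) \<or> (\<exists>\<sigma>>0. distributed M lborel X (normal_density m \<sigma>))"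
    using assms(2) by (auto simp: gaussian_variable_def)
  then show ?thesis
  proof
    assume "AE \<omega> in M. X \<omega> = m"
    then have "AE \<omega> in M. (X \<omega>)\<^sup>2 = m\<^sup>2" by eventually_elim simp
    then show ?thesis by (subst integrable_cong_AE) auto
  next
    assume "\<exists>\<sigma>>0. distributed M lborel X (normal_density m \<sigma>)"
    then obtain \<sigma> where "\<sigma> > 0" and D: "distributed M lborel X (normal_density m \<sigma>)" by blast
    have moment: "integrable M (\<lambda>\<omega>. (X \<omega> - m) ^ k)" for k
      using distributed_integrable[OF D, of "\<lambda>x. (x - m) ^ k"]
        integrable_normal_moment[OF \<open>\<sigma> > 0\<close>, of m k] by simp
    have "integrable M (\<lambda>\<omega>. (X \<omega> - m) ^ 2 + 2 * m * (X \<omega> - m) ^ 1 + m\<^sup>2)"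
      using moment[of 2] moment[of 1]
      by (intro Bochner_Integration.integrable_add integrable_mult_right integrable_const)
    then show ?thesis by (simp add: power2_eq_square algebra_simps)
  qed
qed

lemma gaussian_process_gaussian_variable:
  assumes "gaussian_process M T X" "t \<in> T"
  shows "gaussian_variable M (X t)"
proof -
  have "gaussian_variable M (\<lambda>\<omega>. \<Sum>u\<in>{t}. 1 * X u \<omega>)"
    using assms(1) unfolding gaussian_process_def
    by (elim conjE allE[of _ "{t}"] allE[of _ "\<lambda>_. 1"] impE) (use assms(2) in auto)
  then show ?thesis by simp
qed

lemma R_cov_diagonal:
  assumes "H t \<in> {0<..<1}"
  shows "R_cov H K t t = t powr (2 * H t * K)"
proof -
  have "R_cov H K t t = (1 / 2) powr K * (2 * t powr (H t + H t)) powr K"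
    unfolding R_cov_def D_fun_diagonal[OF assms] by simp
  also have "\<dots> = (t powr (H t + H t)) powr K" by (simp add: powr_mult[symmetric] del: powr_mult)
  finally show ?thesis by (simp add: powr_powr)
qed

text \<open>Expanding the square needs integrability of the three products: without it the Bochner
  integrals, and hence the given covariances, could be the default value \<open>0\<close>. Gaussianity of the
  one-dimensional marginals provides it.\<close>

lemma increment_second_moment:
  assumes B: "multifractional_bifractional_BM M H K B"
    and H: "H t \<in> {0<..<1}" "H s \<in> {0<..<1}" and ts: "0 \<le> t" "0 \<le> s"
  shows "(\<integral>\<omega>. (B t \<omega> - B s \<omega>)\<^sup>2 \<partial>M) = increment_variance K (H t) (H s) t s"
proof -
  have GP: "gaussian_process M {0..} B" and mean: "\<And>u. 0 \<le> u \<Longrightarrow> (\<integral>\<omega>. B u \<omega> \<partial>M) = 0"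
    and cov: "\<And>u v. 0 \<le> u \<Longrightarrow> 0 \<le> v \<Longrightarrow> covariance M (B u) (B v) = R_cov H K u v"
    using B by (auto simp: multifractional_bifractional_BM_def)
  have P: "prob_space M" using GP by (simp add: gaussian_process_def)
  have gv: "gaussian_variable M (B u)" if "0 \<le> u" for u
    using gaussian_process_gaussian_variable[OF GP] that by simp
  have sq: "integrable M (\<lambda>\<omega>. (B u \<omega>)\<^sup>2)" if "0 \<le> u" for u
    using gaussian_variable_square_integrable[OF P gv[OF that]] .
  have meas[measurable]: "B t \<in> borel_measurable M" "B s \<in> borel_measurable M"
    using gv ts by (auto simp: gaussian_variable_def)
  have prod: "integrable M (\<lambda>\<omega>. B t \<omega> * B s \<omega>)"
  proof (rule Bochner_Integration.integrable_bound)
    show "integrable M (\<lambda>\<omega>. (B t \<omega>)\<^sup>2 + (B s \<omega>)\<^sup>2)" using sq ts by simp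
    have "\<bar>x * y\<bar> \<le> x\<^sup>2 + y\<^sup>2" for x y :: real
    proof -
      have "2 * (\<bar>x\<bar> * \<bar>y\<bar>) \<le> x\<^sup>2 + y\<^sup>2"
        using sum_squares_bound[of "\<bar>x\<bar>" "\<bar>y\<bar>"] by simp
      moreover have "0 \<le> \<bar>x\<bar> * \<bar>y\<bar>" by simp
      ultimately show ?thesis unfolding abs_mult by linarith
    qed
    then show "AE \<omega> in M. norm (B t \<omega> * B s \<omega>) \<le> norm ((B t \<omega>)\<^sup>2 + (B s \<omega>)\<^sup>2)" by simp
  qed measurable
  have second: "(\<integral>\<omega>. B u \<omega> * B v \<omega> \<partial>M) = R_cov H K u v" if "0 \<le> u" "0 \<le> v" for u v
    using cov[OF that] mean that by (simp add: covariance_def)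
  have "(\<integral>\<omega>. (B t \<omega> - B s \<omega>)\<^sup>2 \<partial>M)
      = (\<integral>\<omega>. (B t \<omega>)\<^sup>2 + (B s \<omega>)\<^sup>2 - 2 * (B t \<omega> * B s \<omega>) \<partial>M)"
    by (simp add: power2_diff mult.assoc)
  also have "\<dots> = (\<integral>\<omega>. (B t \<omega>)\<^sup>2 \<partial>M) + (\<integral>\<omega>. (B s \<omega>)\<^sup>2 \<partial>M) - 2 * (\<integral>\<omega>. B t \<omega> * B s \<omega> \<partial>M)"
    using sq ts prod by simp
  also have "\<dots> = R_cov H K t t + R_cov H K s s - 2 * R_cov H K t s"
    using second ts by (simp add: power2_eq_square)
  also have "\<dots> = increment_variance K (H t) (H s) t s"
    using R_cov_diagonal H ts by (simp add: increment_variance_def R_cov_def)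
  finally show ?thesis .
qed

section \<open>The increment bound\<close>

theorem theorem1:
  fixes \<mu> \<nu> K L :: real
  assumes "0 < \<mu>" "\<mu> \<le> \<nu>" "\<nu> < 1"
    and "0 < K" "K \<le> 1"
  shows "\<exists>C>0. \<forall>\<beta> H (M :: 'a measure) B.
    0 < \<beta> \<longrightarrow>
    H \<in> {0..} \<rightarrow> {\<mu>..\<nu>} \<longrightarrow>
    holder_on L \<beta> {0..} H \<longrightarrow>
    (SUP t\<in>{0..}. H t) < \<beta> \<longrightarrow>
    multifractional_bifractional_BM M H K B \<longrightarrow>
    (\<forall>t\<in>{0..1}. \<forall>s\<in>{0..1}.
      (\<integral>\<omega>. (B t \<omega> - B s \<omega>)\<^sup>2 \<partial>M) \<le> C * \<bar>t - s\<bar> powr (2 * max (H t) (H s) * K))"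
proof -
  \<comment> \<open>A negative \<open>L\<close> admits no Hoelder function at all; \<open>max L 0\<close> covers it without a case split.\<close>
  obtain C where C: "C > 0" and bound: "\<And>a b t s. a \<in> {\<mu>..\<nu>} \<Longrightarrow> b \<in> {\<mu>..\<nu>} \<Longrightarrow> t \<in> {0..1} \<Longrightarrow>
      s \<in> {0..1} \<Longrightarrow> \<bar>a - b\<bar> \<le> max L 0 * \<bar>t - s\<bar> powr max a b \<Longrightarrow>
      increment_variance K a b t s \<le> C * \<bar>t - s\<bar> powr (2 * max a b * K)"
    using increment_variance_bound[OF assms, of "max L 0"] by auto
  have "(\<integral>\<omega>. (B t \<omega> - B s \<omega>)\<^sup>2 \<partial>M) \<le> C * \<bar>t - s\<bar> powr (2 * max (H t) (H s) * K)"
    if H: "H \<in> {0..} \<rightarrow> {\<mu>..\<nu>}" and hold: "holder_on L \<beta> {0..} H"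
      and sup: "(SUP t\<in>{0..}. H t) < \<beta>" and B: "multifractional_bifractional_BM M H K B"
      and ts: "t \<in> {0..1}" "s \<in> {0..1}"
    for \<beta> H B t s and M :: "'a measure"
  proof -
    have Hts: "H t \<in> {\<mu>..\<nu>}" "H s \<in> {\<mu>..\<nu>}" using H ts by auto
    have "bdd_above (H ` {0..})" using H by (intro bdd_aboveI[of _ \<nu>]) auto
    then have "H u < \<beta>" if "0 \<le> u" for u
      using cSUP_upper[of u "{0..}" H] sup that by simp
    then have m: "max (H t) (H s) \<le> \<beta>" using ts by (simp add: less_imp_le)
    have "\<bar>H t - H s\<bar> \<le> L * \<bar>t - s\<bar> powr \<beta>" and "0 \<le> L"
      using hold ts by (auto simp: holder_on_def dist_real_def)
    moreover have "\<bar>t - s\<bar> powr \<beta> \<le> \<bar>t - s\<bar> powr max (H t) (H s)"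
      using ts by (intro powr_mono' m) auto
    ultimately have "\<bar>H t - H s\<bar> \<le> max L 0 * \<bar>t - s\<bar> powr max (H t) (H s)"
      by (metis (no_types) max.absorb1 mult_left_mono order_trans)
    from bound[OF Hts ts this] show ?thesis
      using increment_second_moment[OF B] Hts ts assms by simp
  qed
  with C show ?thesis by blast
qed

end
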